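(* Let $E_*=\{m+n\sqrt{-1}:(m,n)\in\mathbb{Z}\times\mathbb{Z},\ m\ge1\}$, $J=\{z\in\mathbb{C}:|z-1/2|\le1/2\}$, and $T_e(z)=1/(e+z)$ for $e\in E_*$. There exist a nonempty set $\hat E\subset E_*$ and a subset $E\subset\hat E$ such that the limit set $K$ of the system $(T_e)_{e\in E}$ on $J$ has positive Hausdorff dimension and such that, defining for $e\in\hat E$ and $\epsilon\in(0,1)$ $$T_e(\epsilon,z)=\begin{cases}T_e(z),&e\in E,\\ \dfrac{1}{e+\frac12+\epsilon(z-\frac12)},&e\in\hat E\setminus E,\end{cases}$$ and letting $K(\epsilon)$ be the limit set of the system $(T_e(\epsilon,\cdot))_{e\in\hat E}$ on $J$, the Hausdorff dimension $\dim_H K(\epsilon)$ does not converge to $\dim_H K$ as $\epsilon\to0$.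
   Context: $\dim_H$ denotes Hausdorff dimension in $\mathbb{C}\cong\mathbb{R}^2$. Let $F\subset\{m+n\sqrt{-1}:(m,n)\in\mathbb{Z}\times\mathbb{Z},\ m\ge1\}$ be nonempty and let $(S_e)_{e\in F}$ be a system of maps $S_e:J\to J$ such that, for a fixed $\epsilon\in(0,1)$, each $S_e$ is either $z\mapsto\frac{1}{e+z}$ or $z\mapsto\frac{1}{e+\frac12+\epsilon(z-\frac12)}$. The limit set of $(S_e)_{e\in F}$ is $\pi(F^{\mathbb{Z}_{\ge0}})$, where $\{\pi(\omega)\}=\bigcap_{k\ge0}S_{\omega_0}\circ\cdots\circ S_{\omega_k}(J)$ for $\omega=\omega_0\omega_1\cdots\in F^{\mathbb{Z}_{\ge0}}$. *)

theory Defs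
  imports "HOL-Analysis.Analysis"
begin

text \<open>
  Hausdorff measure and dimension in a metric space. The term \<open>diam(U)\<^sup>s\<close> is taken to be 0 for
  empty \<open>U\<close>, and 1 for nonempty \<open>U\<close> if \<open>s = 0\<close>; the case distinction is needed because
  \<open>0 powr 0 = 0\<close>.
\<close>

definition diam_powr :: "real \<Rightarrow> 'a::metric_space set \<Rightarrow> ennreal" where
  "diam_powr s U =
     (if U = {} then 0 else if s = 0 then 1 else ennreal (diameter U powr s))"

text \<open>Boundedness is explicit because \<open>diameter\<close> is meaningless on unbounded sets.\<close>

definition countable_covers :: "real \<Rightarrow> 'a::metric_space set \<Rightarrow> (nat \<Rightarrow> 'a set) set" where
  "countable_covers \<delta> A =
     {U. A \<subseteq> (\<Union>i. U i) \<and> (\<forall>i. bounded (U i) \<and> diameter (U i) \<le> \<delta>)}"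

definition hausdorff_premeasure :: "real \<Rightarrow> real \<Rightarrow> 'a::metric_space set \<Rightarrow> ennreal" where
  "hausdorff_premeasure s \<delta> A = (INF U\<in>countable_covers \<delta> A. \<Sum>i. diam_powr s (U i))"

definition hausdorff_measure :: "real \<Rightarrow> 'a::metric_space set \<Rightarrow> ennreal" where
  "hausdorff_measure s A = (SUP \<delta>\<in>{0<..}. hausdorff_premeasure s \<delta> A)"

text \<open>Extended-valued, so that the infimum over the empty set is \<open>\<infinity>\<close>.\<close>

definition hausdorff_dim :: "'a::metric_space set \<Rightarrow> ennreal" where
  "hausdorff_dim A = (INF s\<in>{s. 0 \<le> s \<and> hausdorff_measure s A = 0}. ennreal s)"

text \<open>\<open>word_map S \<omega> k = S (\<omega> 0) \<circ> \<dots> \<circ> S (\<omega> k)\<close>, with \<open>k + 1\<close> factors.\<close>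

primrec word_map :: "('i \<Rightarrow> 'a \<Rightarrow> 'a) \<Rightarrow> (nat \<Rightarrow> 'i) \<Rightarrow> nat \<Rightarrow> 'a \<Rightarrow> 'a" where
  "word_map S \<omega> 0 = S (\<omega> 0)"
| "word_map S \<omega> (Suc k) = word_map S \<omega> k \<circ> S (\<omega> (Suc k))"

text \<open>
  The coding map is meaningful only if the intersection is a singleton, as it is for the
  continued fraction systems below.
\<close>

definition coding_map :: "'a set \<Rightarrow> ('i \<Rightarrow> 'a \<Rightarrow> 'a) \<Rightarrow> (nat \<Rightarrow> 'i) \<Rightarrow> 'a" where
  "coding_map X S \<omega> = (THE z. (\<Inter>k. word_map S \<omega> k ` X) = {z})"

definition limit_set :: "'a set \<Rightarrow> 'i set \<Rightarrow> ('i \<Rightarrow> 'a \<Rightarrow> 'a) \<Rightarrow> 'a set" where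
  "limit_set X F S = coding_map X S ` {\<omega>. \<forall>n. \<omega> n \<in> F}"

definition E_star :: "complex set" where
  "E_star = {of_int m + of_int n * \<i> | m n :: int. 1 \<le> m}"

definition J :: "complex set" where
  "J = {z. cmod (z - 1/2) \<le> 1/2}"

definition T :: "complex \<Rightarrow> complex \<Rightarrow> complex" where
  "T e z = 1 / (e + z)"

definition T_pert :: "complex set \<Rightarrow> real \<Rightarrow> complex \<Rightarrow> complex \<Rightarrow> complex" where
  "T_pert E \<epsilon> e z =
     (if e \<in> E then T e z else 1 / (e + 1/2 + of_real \<epsilon> * (z - 1/2)))"

end

theory Submission
  imports Defs
begin

text \<open>
  The perturbed maps contract more and more strongly as \<open>\<epsilon> \<rightarrow> 0\<close>, so a finite set of perturbed digits
  contributes nothing to the dimension in the limit. Infinitely many digits behave differently. For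
  a digit \<open>e\<close> the contraction ratio is of order \<open>\<epsilon> / |e|\<^sup>2\<close>, and for digits \<open>1, 2, 3, \<dots>\<close> the series
  \<open>\<Sum> (\<epsilon> / m\<^sup>2)\<^sup>t\<close> diverges for all \<open>t \<le> 1/2\<close>, whatever the value of \<open>\<epsilon> > 0\<close>. Hence the perturbed
  digits alone force the dimension to stay near or above \<open>1/2\<close>, uniformly in \<open>\<epsilon>\<close>. It suffices to combine them
  with an unperturbed system \<open>E\<close> of positive but smaller dimension.

  The proof takes \<open>E = {16, 18}\<close> and the integers \<open>m \<ge> 16\<close> for the large alphabet. The two maps of \<open>E\<close>
  contract by at least \<open>16\<^sup>2 = 4\<^sup>4\<close>, so the dimension is at most \<open>1/4\<close>
  (\<open>hausdorff_dim_fixed_le\<close>); they contract by less than \<open>2\<^sup>9\<close> and have disjoint images, so it is at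
  least \<open>1/9\<close> (\<open>hausdorff_dim_fixed_ge\<close>). For \<open>0 < \<epsilon> < 1\<close>, the \<open>N\<close> digits from \<open>N\<close> to \<open>2N - 1\<close> have
  contraction ratios at least \<open>\<epsilon> / (2N)\<^sup>2\<close>, which is at least \<open>N\<^sup>-\<^sup>3\<close> as soon as \<open>N \<ge> 4 / \<epsilon>\<close>; so the dimension of
  the perturbed limit set is at least \<open>1/3\<close> for every \<open>\<epsilon>\<close> (\<open>hausdorff_dim_perturbed_ge\<close>).

  These bounds come from two general results on a finite contracting system with \<open>n\<close> maps: the
  dimension is at most \<open>s\<close> if all maps contract by a factor \<open>c\<close> with \<open>n c\<^sup>s < 1\<close>
  (\<open>hausdorff_dim_limit_set_le\<close>, by covering with cylinders), and at least \<open>s\<close> if the images are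
  separated and no map shrinks a distance below \<open>r\<close> times its value, where \<open>n r\<^sup>s \<ge> 1\<close>
  (\<open>hausdorff_dim_limit_set_ge\<close>). The lower bound needs no measure on the limit set: reading base \<open>n\<close>
  expansions as words gives a map from \<open>[0,1)\<close> into the limit set whose inverse is Hoelder with
  exponent \<open>s\<close>, and an efficient cover of the limit set would pull back to a cover of \<open>[0,1)\<close> of small
  Lebesgue measure (\<open>hausdorff_dim_ge_Hoelder_inverse\<close>).
\<close>

section \<open>Two estimates for Hausdorff dimension\<close>

lemma diameter_le_dist_bound:
  fixes A :: "'a::metric_space set"
  assumes "0 \<le> d" "\<And>x y. x \<in> A \<Longrightarrow> y \<in> A \<Longrightarrow> dist x y \<le> d"
  shows "diameter A \<le> d"
  unfolding diameter_def using assms by (auto intro!: cSUP_least)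

text \<open>
  Padding a finite cover by empty sets makes it a countable one at no cost, because \<open>diam_powr\<close> of the
  empty set vanishes even for \<open>s = 0\<close>.
\<close>

lemma hausdorff_premeasure_finite_cover:
  fixes V :: "'j \<Rightarrow> 'a::metric_space set"
  assumes fin: "finite I" and cov: "A \<subseteq> (\<Union>i\<in>I. V i)" and "0 \<le> \<delta>"
    and small: "\<And>i. i \<in> I \<Longrightarrow> bounded (V i) \<and> diameter (V i) \<le> \<delta>"
  shows "hausdorff_premeasure s \<delta> A \<le> (\<Sum>i\<in>I. diam_powr s (V i))"
proof -
  obtain g where g: "bij_betw g {0..<card I} I"
    using ex_bij_betw_nat_finite[OF fin] by blast
  define U where "U k = (if k < card I then V (g k) else {})" for k
  have gI: "g k \<in> I" if "k < card I" for k
    using g that by (auto simp: bij_betw_def)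
  have "A \<subseteq> (\<Union>k. U k)"
  proof
    fix x assume "x \<in> A"
    then obtain i where i: "i \<in> I" "x \<in> V i" using cov by blast
    then obtain k where "k < card I" "g k = i"
      using g unfolding bij_betw_def by force
    then show "x \<in> (\<Union>k. U k)" using i by (auto simp: U_def)
  qed
  then have "U \<in> countable_covers \<delta> A"
    using small gI \<open>0 \<le> \<delta>\<close> by (auto simp: countable_covers_def U_def)
  then have "hausdorff_premeasure s \<delta> A \<le> (\<Sum>k. diam_powr s (U k))"
    unfolding hausdorff_premeasure_def by (rule INF_lower)
  also have "\<dots> = (\<Sum>k\<in>{0..<card I}. diam_powr s (U k))"
    by (rule suminf_finite) (auto simp: U_def diam_powr_def)
  also have "\<dots> = (\<Sum>k\<in>{0..<card I}. diam_powr s (V (g k)))"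
    by (rule sum.cong) (auto simp: U_def)
  also have "\<dots> = (\<Sum>i\<in>I. diam_powr s (V i))"
    by (rule sum.reindex_bij_betw[OF g])
  finally show ?thesis .
qed

text \<open>
  A substitute for the mass distribution principle. If \<open>U\<close> covers \<open>A\<close>, the preimages \<open>h\<^sup>-\<^sup>1(U i)\<close> cover
  \<open>[0,1)\<close>, and each of them lies in an interval of length \<open>2 C diameter (U i)\<^sup>s\<close>. So these lengths add up to at least 1, and
  the \<open>t\<close>-dimensional measure of \<open>A\<close> is positive for all \<open>t < s\<close>. The preimages may fail to
  be measurable; the enclosing intervals are measured instead.
\<close>

lemma hausdorff_dim_ge_Hoelder_inverse:
  fixes h :: "real \<Rightarrow> 'a::metric_space"
  assumes hA: "\<And>x. x \<in> {0..<1} \<Longrightarrow> h x \<in> A"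
    and hoelder: "\<And>x y. x \<in> {0..<1} \<Longrightarrow> y \<in> {0..<1} \<Longrightarrow> \<bar>x - y\<bar> \<le> C * dist (h x) (h y) powr s"
    and C: "0 < C" and s: "0 < s"
  shows "ennreal s \<le> hausdorff_dim A"
  unfolding hausdorff_dim_def
proof (rule INF_greatest)
  fix t :: real assume "t \<in> {t. 0 \<le> t \<and> hausdorff_measure t A = 0}"
  then have t: "0 \<le> t" and null: "hausdorff_measure t A = 0" by auto
  have "s \<le> t"
  proof (rule ccontr)
    assume "\<not> s \<le> t"
    then have ts: "t < s" by simp
    \<comment> \<open>Diameters at most 1 are small enough: they make \<open>diameter\<^sup>s \<le> diameter\<^sup>t\<close>.\<close>
    have "hausdorff_premeasure t 1 A \<le> hausdorff_measure t A"
      unfolding hausdorff_measure_def by (rule SUP_upper) simp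
    then have "hausdorff_premeasure t 1 A < ennreal (1 / (2 * C))"
      using null C by simp
    then obtain U where U: "U \<in> countable_covers 1 A"
      and less: "(\<Sum>i. diam_powr t (U i)) < ennreal (1 / (2 * C))"
      unfolding hausdorff_premeasure_def by (auto simp: INF_less_iff)
    have cov: "A \<subseteq> (\<Union>i. U i)" and bdd: "\<And>i. bounded (U i)"
      and diam: "\<And>i. diameter (U i) \<le> 1"
      using U by (auto simp: countable_covers_def)
    have "\<exists>B\<in>sets lborel. {x\<in>{0..<1}. h x \<in> U i} \<subseteq> B \<and>
            emeasure lborel B \<le> ennreal (2 * C) * diam_powr t (U i)" for i
    proof (cases "\<exists>x\<in>{0..<1}. h x \<in> U i")
      case False
      then show ?thesis by (intro bexI[of _ "{}"]) auto
    next
      case True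
      then obtain x where x: "x \<in> {0..<1}" "h x \<in> U i" by blast
      define r where "r = C * diameter (U i) powr s"
      have "\<bar>x - y\<bar> \<le> r" if "y \<in> {0..<1}" "h y \<in> U i" for y
      proof -
        have "dist (h x) (h y) \<le> diameter (U i)"
          using x that bdd by (intro diameter_bounded_bound) auto
        then have "dist (h x) (h y) powr s \<le> diameter (U i) powr s"
          using s by (intro powr_mono2) auto
        then have "C * dist (h x) (h y) powr s \<le> r"
          unfolding r_def using C by (intro mult_left_mono) auto
        then show ?thesis using hoelder[OF x(1) that(1)] by linarith
      qed
      then have sub: "{y\<in>{0..<1}. h y \<in> U i} \<subseteq> {x - r..x + r}"
        by (fastforce simp: abs_le_iff)
      have r0: "0 \<le> r" unfolding r_def using C by simp
      have d0: "0 \<le> diameter (U i)" by (rule diameter_ge_0[OF bdd])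
      have "ennreal (diameter (U i) powr s) \<le> diam_powr t (U i)"
      proof (cases "t = 0")
        case True
        have "diameter (U i) powr s \<le> 1"
          using diam[of i] d0 s by (simp add: powr_le1)
        then show ?thesis using True x by (auto simp: diam_powr_def)
      next
        case False
        have "diameter (U i) powr s \<le> diameter (U i) powr t"
          using diam[of i] d0 ts by (intro powr_mono') auto
        then show ?thesis using False x by (auto simp: diam_powr_def intro: ennreal_leI)
      qed
      then have "ennreal (2 * C) * ennreal (diameter (U i) powr s)
          \<le> ennreal (2 * C) * diam_powr t (U i)"
        by (intro mult_left_mono) auto
      moreover have "emeasure lborel {x - r..x + r}
          = ennreal (2 * C) * ennreal (diameter (U i) powr s)"
        using r0 C by (simp add: r_def ennreal_mult[symmetric] algebra_simps)
      ultimately show ?thesis using sub by (intro bexI[of _ "{x - r..x + r}"]) auto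
    qed
    then obtain B where B: "\<And>i. B i \<in> sets lborel"
      "\<And>i. {x\<in>{0..<1}. h x \<in> U i} \<subseteq> B i"
      "\<And>i. emeasure lborel (B i) \<le> ennreal (2 * C) * diam_powr t (U i)"
      by metis
    have "{0..<1} \<subseteq> (\<Union>i. B i)" using hA cov B(2) by blast
    then have "emeasure lborel {0..<1::real} \<le> emeasure lborel (\<Union>i. B i)"
      using B(1) by (intro emeasure_mono) auto
    also have "\<dots> \<le> (\<Sum>i. emeasure lborel (B i))"
      using B(1) by (intro emeasure_subadditive_countably) auto
    also have "\<dots> \<le> (\<Sum>i. ennreal (2 * C) * diam_powr t (U i))"
      using B(3) by (intro suminf_le) auto
    also have "\<dots> = ennreal (2 * C) * (\<Sum>i. diam_powr t (U i))"
      by (rule ennreal_suminf_cmult)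
    also have "\<dots> < ennreal (2 * C) * ennreal (1 / (2 * C))"
      using less C by (intro ennreal_mult_strict_left_mono) auto
    also have "\<dots> = 1" using C by (simp add: ennreal_mult[symmetric])
    finally show False by simp
  qed
  then show "ennreal s \<le> ennreal t" by (rule ennreal_leI)
qed

section \<open>Coding maps of uniformly contracting systems\<close>

lemma power_powr:
  fixes c s :: real
  assumes "0 < c"
  shows "(c ^ k) powr s = (c powr s) ^ k"
  using assms by (induction k) (simp_all add: powr_mult)

lemma word_map_cong:
  assumes "\<And>i. i \<le> k \<Longrightarrow> \<omega> i = \<omega>' i"
  shows "word_map S \<omega> k = word_map S \<omega>' k"
  using assms by (induction k) auto

text \<open>
  The constant \<open>c\<close> is required to be positive, so that powers \<open>c powr s\<close> in the dimension estimates obey the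
  usual laws; enlarging a contraction constant 0 is harmless.
\<close>

locale contracting_system =
  fixes X :: "'a::complete_space set" and F :: "'i set" and S :: "'i \<Rightarrow> 'a \<Rightarrow> 'a" and c :: real
  assumes compact: "compact X" and nonempty: "X \<noteq> {}"
    and maps: "\<And>e x. e \<in> F \<Longrightarrow> x \<in> X \<Longrightarrow> S e x \<in> X"
    and contr: "\<And>e x y. e \<in> F \<Longrightarrow> x \<in> X \<Longrightarrow> y \<in> X \<Longrightarrow> dist (S e x) (S e y) \<le> c * dist x y"
    and c_pos: "0 < c" and c_less_1: "c < 1"
begin

lemma word_map_contr:
  assumes "\<And>n. \<omega> n \<in> F" "x \<in> X" "y \<in> X"
  shows "dist (word_map S \<omega> k x) (word_map S \<omega> k y) \<le> c ^ Suc k * dist x y"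
  using assms(2,3)
proof (induction k arbitrary: x y)
  case 0
  then show ?case using contr[OF assms(1)] by simp
next
  case (Suc k)
  have "dist (word_map S \<omega> (Suc k) x) (word_map S \<omega> (Suc k) y)
      \<le> c ^ Suc k * dist (S (\<omega> (Suc k)) x) (S (\<omega> (Suc k)) y)"
    using Suc.IH[of "S (\<omega> (Suc k)) x" "S (\<omega> (Suc k)) y"] maps[OF assms(1)] Suc.prems by simp
  also have "\<dots> \<le> c ^ Suc k * (c * dist x y)"
    using contr[OF assms(1) Suc.prems] c_pos by (intro mult_left_mono) auto
  finally show ?case by (simp add: algebra_simps)
qed

lemma word_map_expand:
  assumes "\<And>n. \<omega> n \<in> F" "x \<in> X" "y \<in> X" "0 \<le> r"
    and "\<And>e x y. e \<in> F \<Longrightarrow> x \<in> X \<Longrightarrow> y \<in> X \<Longrightarrow> r * dist x y \<le> dist (S e x) (S e y)"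
  shows "r ^ Suc k * dist x y \<le> dist (word_map S \<omega> k x) (word_map S \<omega> k y)"
  using assms(2,3)
proof (induction k arbitrary: x y)
  case 0
  then show ?case using assms(5)[OF assms(1)] by simp
next
  case (Suc k)
  have "r ^ Suc (Suc k) * dist x y = r ^ Suc k * (r * dist x y)" by simp
  also have "\<dots> \<le> r ^ Suc k * dist (S (\<omega> (Suc k)) x) (S (\<omega> (Suc k)) y)"
    using assms(5)[OF assms(1) Suc.prems] assms(4) by (intro mult_left_mono) auto
  also have "\<dots> \<le> dist (word_map S \<omega> (Suc k) x) (word_map S \<omega> (Suc k) y)"
    using Suc.IH[of "S (\<omega> (Suc k)) x" "S (\<omega> (Suc k)) y"] maps[OF assms(1)] Suc.prems by simp
  finally show ?case .
qed

lemma diameter_X_ge_0: "0 \<le> diameter X"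
  by (rule diameter_ge_0[OF compact_imp_bounded[OF compact]])

lemma dist_le_diameter_X: "x \<in> X \<Longrightarrow> y \<in> X \<Longrightarrow> dist x y \<le> diameter X"
  by (rule diameter_bounded_bound[OF compact_imp_bounded[OF compact]])

lemma cylinder_dist_le:
  assumes "\<And>n. \<omega> n \<in> F" "x \<in> word_map S \<omega> k ` X" "y \<in> word_map S \<omega> k ` X"
  shows "dist x y \<le> c ^ Suc k * diameter X"
proof -
  obtain a b where ab: "a \<in> X" "b \<in> X" "x = word_map S \<omega> k a" "y = word_map S \<omega> k b"
    using assms by auto
  have "dist x y \<le> c ^ Suc k * dist a b" unfolding ab by (rule word_map_contr[OF assms(1) ab(1,2)])
  also have "\<dots> \<le> c ^ Suc k * diameter X"
    using dist_le_diameter_X[OF ab(1,2)] c_pos by (intro mult_left_mono) auto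
  finally show ?thesis .
qed

lemma cylinder_compact:
  assumes "\<And>n. \<omega> n \<in> F"
  shows "compact (word_map S \<omega> k ` X)"
proof (rule compact_continuous_image[OF _ compact])
  have "(c ^ Suc k)-lipschitz_on X (word_map S \<omega> k)"
    using word_map_contr[OF assms] c_pos by (intro lipschitz_onI) auto
  then show "continuous_on X (word_map S \<omega> k)" by (rule lipschitz_on_continuous_on)
qed

lemma cylinder_shrinks:
  assumes "0 < (\<epsilon>::real)"
  shows "\<exists>k0. \<forall>k\<ge>k0. c ^ Suc k * diameter X < \<epsilon>"
proof -
  have "(\<lambda>k. c ^ Suc k * diameter X) \<longlonglongrightarrow> 0 * diameter X"
    using c_pos c_less_1 by (intro tendsto_intros LIMSEQ_Suc LIMSEQ_realpow_zero) auto
  then show ?thesis using order_tendstoD(2)[of _ 0 sequentially \<epsilon>] assms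
    by (auto simp: eventually_sequentially)
qed

text \<open>
  The cylinders of a word are nested compact sets whose diameters tend to 0, so the definite description in
  \<open>coding_map\<close> denotes the unique point of their intersection.
\<close>

lemma coding_map_unique:
  assumes "\<And>n. \<omega> n \<in> F"
  shows "(\<Inter>k. word_map S \<omega> k ` X) = {coding_map X S \<omega>}"
proof -
  have dec: "word_map S \<omega> (Suc k) ` X \<subseteq> word_map S \<omega> k ` X" for k
    using maps[OF assms] by auto
  have "\<exists>a. \<Inter>(range (\<lambda>k. word_map S \<omega> k ` X)) = {a}"
  proof (rule decreasing_closed_nest_sing)
    show "closed (word_map S \<omega> k ` X)" for k
      using cylinder_compact[OF assms] by (rule compact_imp_closed)
    show "word_map S \<omega> k ` X \<noteq> {}" for k using nonempty by simp
    show "word_map S \<omega> n ` X \<subseteq> word_map S \<omega> m ` X" if "m \<le> n" for m n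
      using that dec by (rule lift_Suc_antimono_le[rotated])
    show "\<exists>n. \<forall>x\<in>word_map S \<omega> n ` X. \<forall>y\<in>word_map S \<omega> n ` X. dist x y < \<epsilon>"
      if "0 < \<epsilon>" for \<epsilon> :: real
      using cylinder_shrinks[OF that] cylinder_dist_le[OF assms] by (meson le_less_trans order_refl)
  qed
  then obtain a where "(\<Inter>k. word_map S \<omega> k ` X) = {a}" by auto
  then show ?thesis unfolding coding_map_def by simp
qed

lemma coding_map_in_cylinder:
  assumes "\<And>n. \<omega> n \<in> F"
  shows "coding_map X S \<omega> \<in> word_map S \<omega> k ` X"
proof -
  have "coding_map X S \<omega> \<in> (\<Inter>k. word_map S \<omega> k ` X)"
    by (subst coding_map_unique[OF assms]) simp_all
  then show ?thesis by (rule INT_D) simp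
qed

section \<open>An upper bound for the dimension\<close>

text \<open>
  The cover consists of the cylinders of the \<open>n\<^sup>k\<^sup>+\<^sup>1\<close> words of length \<open>k + 1\<close>, where \<open>n\<close> is the number of maps.
\<close>

lemma hausdorff_premeasure_limit_set_le:
  assumes "finite F" "0 < s" "c ^ Suc k * diameter X \<le> \<delta>"
  shows "hausdorff_premeasure s \<delta> (limit_set X F S)
    \<le> ennreal ((real (card F) * c powr s) ^ Suc k * diameter X powr s)"
proof -
  define L where "L = {xs. set xs \<subseteq> F \<and> length xs = Suc k}"
  \<comment> \<open>\<open>word_map\<close> expects an infinite word; repeating the last letter keeps all letters in \<open>F\<close>.\<close>
  define W where "W xs = word_map S (\<lambda>i. xs ! min i k) k ` X" for xs
  have inF: "xs ! min i k \<in> F" if "xs \<in> L" for xs i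
    using that by (auto simp: L_def)
  have finL: "finite L" unfolding L_def using assms(1) by (rule finite_lists_length_eq)
  have cardL: "card L = card F ^ Suc k" unfolding L_def using assms(1) by (rule card_lists_length_eq)
  have d0: "0 \<le> c ^ Suc k * diameter X"
    using c_pos diameter_X_ge_0 by simp
  have bW: "bounded (W xs)" and dW: "diameter (W xs) \<le> c ^ Suc k * diameter X" if "xs \<in> L" for xs
  proof -
    show "bounded (W xs)" unfolding W_def
      by (intro compact_imp_bounded cylinder_compact inF that)
    show "diameter (W xs) \<le> c ^ Suc k * diameter X"
      using cylinder_dist_le[of "\<lambda>i. xs ! min i k", OF inF[OF that]]
      unfolding W_def by (intro diameter_le_dist_bound d0)
  qed
  have cover: "limit_set X F S \<subseteq> (\<Union>xs\<in>L. W xs)"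
  proof
    fix z assume "z \<in> limit_set X F S"
    then obtain \<omega> where \<omega>: "\<And>n. \<omega> n \<in> F" "z = coding_map X S \<omega>"
      by (auto simp: limit_set_def)
    define xs where "xs = map \<omega> [0..<Suc k]"
    have "xs \<in> L" using \<omega> by (auto simp: L_def xs_def)
    moreover have "word_map S (\<lambda>i. xs ! min i k) k = word_map S \<omega> k"
      by (rule word_map_cong) (simp add: xs_def del: upt_Suc)
    then have "z \<in> W xs" using coding_map_in_cylinder[OF \<omega>(1)] \<omega>(2) by (simp add: W_def)
    ultimately show "z \<in> (\<Union>xs\<in>L. W xs)" by blast
  qed
  have "hausdorff_premeasure s \<delta> (limit_set X F S) \<le> (\<Sum>xs\<in>L. diam_powr s (W xs))"
    using bW dW assms(3) d0
    by (intro hausdorff_premeasure_finite_cover[OF finL cover]) force+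
  also have "\<dots> \<le> (\<Sum>xs\<in>L. ennreal ((c ^ Suc k * diameter X) powr s))"
  proof (rule sum_mono)
    fix xs assume "xs \<in> L"
    then have "diameter (W xs) powr s \<le> (c ^ Suc k * diameter X) powr s"
      using dW bW assms(2) by (intro powr_mono2 diameter_ge_0) auto
    then show "diam_powr s (W xs) \<le> ennreal ((c ^ Suc k * diameter X) powr s)"
      using assms(2) by (auto simp: diam_powr_def intro: ennreal_leI)
  qed
  also have "\<dots> = ennreal (real (card F ^ Suc k) * (c ^ Suc k * diameter X) powr s)"
    by (simp add: cardL ennreal_mult ennreal_of_nat_eq_real_of_nat)
  also have "(c ^ Suc k * diameter X) powr s = (c powr s) ^ Suc k * diameter X powr s"
    using c_pos diameter_X_ge_0 by (simp add: powr_mult power_powr del: power_Suc)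
  finally show ?thesis by (simp add: power_mult_distrib mult.assoc del: power_Suc)
qed

theorem hausdorff_dim_limit_set_le:
  assumes "finite F" "0 < s" "real (card F) * c powr s < 1"
  shows "hausdorff_dim (limit_set X F S) \<le> ennreal s"
proof -
  have "hausdorff_premeasure s \<delta> (limit_set X F S) \<le> 0" if \<delta>: "0 < \<delta>" for \<delta>
  proof (rule tendsto_lowerbound)
    let ?b = "\<lambda>k. (real (card F) * c powr s) ^ Suc k * diameter X powr s"
    have "(\<lambda>k. (real (card F) * c powr s) ^ Suc k) \<longlonglongrightarrow> 0"
      by (rule LIMSEQ_Suc[OF LIMSEQ_realpow_zero[OF _ assms(3)]]) simp
    then have "?b \<longlonglongrightarrow> 0" by (rule tendsto_mult_left_zero)
    then have "(\<lambda>k. ennreal (?b k)) \<longlonglongrightarrow> ennreal 0" by (rule tendsto_ennrealI)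
    then show "(\<lambda>k. ennreal (?b k)) \<longlonglongrightarrow> 0" by (simp only: ennreal_0)
    obtain k0 where "\<forall>k\<ge>k0. c ^ Suc k * diameter X < \<delta>"
      using cylinder_shrinks[OF \<delta>] by blast
    then show "\<forall>\<^sub>F k in sequentially. hausdorff_premeasure s \<delta> (limit_set X F S) \<le> ennreal (?b k)"
      unfolding eventually_sequentially
      by (intro exI[of _ k0] allI impI hausdorff_premeasure_limit_set_le assms(1,2))
        (auto intro: less_imp_le)
  qed simp
  then have "hausdorff_measure s (limit_set X F S) \<le> 0"
    unfolding hausdorff_measure_def by (intro SUP_least) simp
  then show ?thesis unfolding hausdorff_dim_def using assms(2) by (intro INF_lower) simp
qed

end

section \<open>Base expansions\<close>

text \<open>The \<open>k\<close>-th digit of \<open>x\<close> in base \<open>n\<close>, starting with the first digit after the point as \<open>k = 0\<close>.\<close>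

definition digit :: "nat \<Rightarrow> real \<Rightarrow> nat \<Rightarrow> nat" where
  "digit n x k = nat (\<lfloor>real n ^ Suc k * x\<rfloor> mod int n)"

lemma int_eq_of_div_mod_eq: "a mod m = b mod m \<Longrightarrow> a div m = b div m \<Longrightarrow> a = (b::int)"
  by (metis div_mult_mod_eq)

text \<open>
  The integer with the first \<open>k\<close> digits of \<open>x\<close> is \<open>\<lfloor>n\<^sup>k x\<rfloor>\<close>: dividing \<open>\<lfloor>n\<^sup>k\<^sup>+\<^sup>1 x\<rfloor>\<close> by \<open>n\<close> with remainder gives
  \<open>\<lfloor>n\<^sup>k x\<rfloor>\<close> as the quotient and the next digit as the remainder.
\<close>

lemma floor_eq_of_digits_eq:
  assumes n: "0 < n" and x: "x \<in> {0..<1}" and y: "y \<in> {0..<1}"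
    and "\<And>i. i < k \<Longrightarrow> digit n x i = digit n y i"
  shows "\<lfloor>real n ^ k * x\<rfloor> = \<lfloor>real n ^ k * y\<rfloor>"
  using assms(4)
proof (induction k)
  case 0
  have "\<lfloor>x\<rfloor> = 0" "\<lfloor>y\<rfloor> = 0" using x y by (auto simp: floor_eq_iff)
  then show ?case by simp
next
  case (Suc k)
  have div: "\<lfloor>real n ^ Suc k * u\<rfloor> div int n = \<lfloor>real n ^ k * u\<rfloor>" for u
  proof -
    have "\<lfloor>real n ^ Suc k * u / real_of_int (int n)\<rfloor> = \<lfloor>real n ^ Suc k * u\<rfloor> div int n"
      by (rule floor_divide_real_eq_div) simp
    moreover have "real n ^ Suc k * u / real_of_int (int n) = real n ^ k * u" using n by simp
    ultimately show ?thesis by simp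
  qed
  have "digit n x k = digit n y k" using Suc.prems by simp
  moreover have "0 \<le> \<lfloor>real n ^ Suc k * u\<rfloor> mod int n" for u
    by (rule pos_mod_sign) (use n in simp)
  ultimately have "\<lfloor>real n ^ Suc k * x\<rfloor> mod int n = \<lfloor>real n ^ Suc k * y\<rfloor> mod int n"
    unfolding digit_def by (simp only: eq_nat_nat_iff)
  moreover have "\<lfloor>real n ^ k * x\<rfloor> = \<lfloor>real n ^ k * y\<rfloor>" using Suc.IH Suc.prems by simp
  then have "\<lfloor>real n ^ Suc k * x\<rfloor> div int n = \<lfloor>real n ^ Suc k * y\<rfloor> div int n"
    by (simp only: div)
  ultimately show ?case by (rule int_eq_of_div_mod_eq)
qed

lemma abs_diff_le_of_digits_eq:
  assumes n: "0 < n" and "x \<in> {0..<1}" "y \<in> {0..<1}"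
    and "\<And>i. i < k \<Longrightarrow> digit n x i = digit n y i"
  shows "\<bar>x - y\<bar> \<le> (1 / real n) ^ k"
proof -
  have "\<bar>real n ^ k * x - real n ^ k * y\<bar> \<le> 1"
    using floor_eq_of_digits_eq[OF assms(1-3), OF assms(4), of k] by linarith
  then have "real n ^ k * \<bar>x - y\<bar> \<le> 1"
    by (simp add: abs_mult right_diff_distrib[symmetric])
  then show ?thesis using n by (simp add: field_simps)
qed

lemma digits_inj:
  assumes n: "2 \<le> n" and "x \<in> {0..<1}" "y \<in> {0..<1}" and "\<And>i. digit n x i = digit n y i"
  shows "x = y"
proof -
  have "\<bar>x - y\<bar> \<le> 0"
  proof (rule tendsto_lowerbound)
    show "(\<lambda>k. (1 / real n) ^ k) \<longlonglongrightarrow> 0" using n by (intro LIMSEQ_realpow_zero) auto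
    show "\<forall>\<^sub>F k in sequentially. \<bar>x - y\<bar> \<le> (1 / real n) ^ k"
      using abs_diff_le_of_digits_eq[of n x y] assms by (intro always_eventually allI) auto
  qed simp
  then show ?thesis by simp
qed

section \<open>A lower bound for the dimension\<close>

context contracting_system
begin

text \<open>
  Send \<open>x \<in> [0,1)\<close> to the point of the limit set coded by the base \<open>n\<close> digits of \<open>x\<close>, where \<open>n\<close> is the
  number of maps. If the digits of \<open>x\<close> and \<open>y\<close> first differ at position \<open>k\<close>, then \<open>|x - y| \<le> n\<^sup>-\<^sup>k\<close>. The two image points are
  at distance at least \<open>r\<^sup>k d\<close>, because the separation \<open>d\<close> is shrunk by \<open>k\<close> common maps. As
  \<open>1/n \<le> r\<^sup>s\<close>, this is the inequality needed for the Hoelder criterion, with constant \<open>d\<^sup>-\<^sup>s\<close>.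
\<close>

theorem hausdorff_dim_limit_set_ge:
  assumes "2 \<le> card F" "0 < s" "0 < r" "0 < d"
    and expand: "\<And>e x y. e \<in> F \<Longrightarrow> x \<in> X \<Longrightarrow> y \<in> X \<Longrightarrow> r * dist x y \<le> dist (S e x) (S e y)"
    and sep: "\<And>e e' x y. e \<in> F \<Longrightarrow> e' \<in> F \<Longrightarrow> e \<noteq> e' \<Longrightarrow> x \<in> X \<Longrightarrow> y \<in> X \<Longrightarrow>
      d \<le> dist (S e x) (S e' y)"
    and large: "1 \<le> real (card F) * r powr s"
  shows "ennreal s \<le> hausdorff_dim (limit_set X F S)"
proof -
  define n where "n = card F"
  have n: "2 \<le> n" using assms(1) by (simp add: n_def)
  have "finite F" using assms(1) by (metis card.infinite not_numeral_le_zero)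
  then obtain b where b: "bij_betw b {0..<n} F"
    using ex_bij_betw_nat_finite unfolding n_def by blast
  define \<omega> where "\<omega> x = b \<circ> digit n x" for x
  have digit_less: "digit n x k < n" for x k
  proof -
    have "\<lfloor>real n ^ Suc k * x\<rfloor> mod int n < int n" using n by (intro pos_mod_bound) simp
    then show ?thesis using n unfolding digit_def by linarith
  qed
  have \<omega>F: "\<omega> x k \<in> F" for x k
    using b digit_less[of x k] by (auto simp: \<omega>_def bij_betw_def)
  have \<omega>_eq: "\<omega> x k = \<omega> y k \<longleftrightarrow> digit n x k = digit n y k" for x y k
    using b digit_less by (auto simp: \<omega>_def bij_betw_def inj_on_def)
  define h where "h x = coding_map X S (\<omega> x)" for x
  have apart: "r ^ k * d \<le> dist (h x) (h y)"
    if same: "\<And>i. i < k \<Longrightarrow> \<omega> x i = \<omega> y i" and diff: "\<omega> x k \<noteq> \<omega> y k" for x y k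
  proof -
    obtain u v where uv: "u \<in> X" "v \<in> X" "h x = word_map S (\<omega> x) k u" "h y = word_map S (\<omega> y) k v"
      using coding_map_in_cylinder[of "\<omega> x" k, OF \<omega>F] coding_map_in_cylinder[of "\<omega> y" k, OF \<omega>F]
      unfolding h_def by blast
    have sd: "d \<le> dist (S (\<omega> x k) u) (S (\<omega> y k) v)"
      by (rule sep[OF \<omega>F \<omega>F diff uv(1,2)])
    show ?thesis
    proof (cases k)
      case 0
      then show ?thesis using sd uv by simp
    next
      case (Suc j)
      have "word_map S (\<omega> x) j = word_map S (\<omega> y) j"
        by (rule word_map_cong) (use same Suc in auto)
      then have hy: "h x = word_map S (\<omega> x) j (S (\<omega> x k) u)" "h y = word_map S (\<omega> x) j (S (\<omega> y k) v)"
        using uv Suc by auto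
      have "r ^ k * d \<le> r ^ Suc j * dist (S (\<omega> x k) u) (S (\<omega> y k) v)"
        using sd assms(3) Suc by (auto intro!: mult_left_mono)
      also have "\<dots> \<le> dist (h x) (h y)"
        unfolding hy using assms(3) uv maps[OF \<omega>F] by (intro word_map_expand \<omega>F expand) auto
      finally show ?thesis .
    qed
  qed
  show ?thesis
  proof (rule hausdorff_dim_ge_Hoelder_inverse[where h = h and C = "(1 / d) powr s"])
    show "h x \<in> limit_set X F S" if "x \<in> {0..<1}" for x
      unfolding h_def limit_set_def using \<omega>F by blast
    show "0 < (1 / d) powr s" using assms(4) by simp
    show "0 < s" by fact
    show "\<bar>x - y\<bar> \<le> (1 / d) powr s * dist (h x) (h y) powr s"
      if x: "x \<in> {0..<1}" and y: "y \<in> {0..<1}" for x y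
    proof (cases "\<exists>k. digit n x k \<noteq> digit n y k")
      case False
      then have "x = y" using digits_inj[OF n x y] by blast
      then show ?thesis by simp
    next
      case True
      define k where "k = (LEAST k. digit n x k \<noteq> digit n y k)"
      have diff: "digit n x k \<noteq> digit n y k"
        unfolding k_def by (rule LeastI_ex[OF True])
      have same: "digit n x i = digit n y i" if "i < k" for i
        using not_less_Least that unfolding k_def by blast
      have "\<bar>x - y\<bar> \<le> (1 / real n) ^ k"
        using n same by (intro abs_diff_le_of_digits_eq x y) auto
      also have "\<dots> \<le> (r powr s) ^ k"
        using large n by (intro power_mono) (auto simp: n_def[symmetric] field_simps)
      also have "\<dots> = (r ^ k) powr s"
        by (rule power_powr[OF assms(3), symmetric])
      also have "\<dots> \<le> (dist (h x) (h y) / d) powr s"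
        using apart[of k x y] same diff assms(2,3,4)
        by (intro powr_mono2) (auto simp: \<omega>_eq field_simps)
      also have "\<dots> = (1 / d) powr s * dist (h x) (h y) powr s"
        using assms(4) by (simp add: powr_divide)
      finally show ?thesis .
    qed
  qed
qed

end

section \<open>Continued fraction maps on the disc\<close>

text \<open>
  Taking \<open>\<epsilon> = 1\<close> gives the unperturbed maps, so one family of estimates serves both systems.
\<close>

definition cf_map :: "real \<Rightarrow> complex \<Rightarrow> complex \<Rightarrow> complex" where
  "cf_map \<epsilon> e z = 1 / (e + 1/2 + of_real \<epsilon> * (z - 1/2))"

lemma T_eq_cf_map: "T e z = cf_map 1 e z"
  by (simp add: T_def cf_map_def)

lemma T_pert_eq_cf_map: "e \<notin> E \<Longrightarrow> T_pert E \<epsilon> e z = cf_map \<epsilon> e z"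
  by (simp add: T_pert_def cf_map_def)

lemma J_eq_cball: "J = cball (1/2) (1/2)"
  by (auto simp: J_def dist_norm norm_minus_commute)

text \<open>
  The inversion \<open>w \<mapsto> 1/w\<close> maps the half plane \<open>Re w \<ge> 1\<close> into the disc, because \<open>|1/w - 1/2| \<le> 1/2\<close> says
  that \<open>w\<close> is at least as far from 0 as from 2.
\<close>

lemma inverse_in_J:
  assumes "1 \<le> Re w"
  shows "1 / w \<in> J"
proof -
  have w0: "w \<noteq> 0" using assms by auto
  have "(cmod (2 - w))\<^sup>2 \<le> (cmod w)\<^sup>2"
    unfolding cmod_power2 using assms by (simp add: power2_eq_square algebra_simps)
  then have "cmod (2 - w) \<le> cmod w" by (rule power2_le_imp_le) simp
  moreover have "1 / w - 1 / 2 = (2 - w) / (2 * w)" using w0 by (simp add: field_simps)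
  ultimately show ?thesis using w0 by (simp add: J_def norm_divide norm_mult)
qed

lemma dist_inverse_complex:
  assumes "(v::complex) \<noteq> 0" "w \<noteq> 0"
  shows "dist (1 / v) (1 / w) = dist v w / (cmod v * cmod w)"
proof -
  have "1 / v - 1 / w = (w - v) / (v * w)" using assms by (simp add: field_simps)
  then show ?thesis by (simp add: dist_norm norm_divide norm_mult norm_minus_commute)
qed

lemma cf_denominator_bounds:
  assumes "0 < \<epsilon>" "\<epsilon> \<le> 1" "z \<in> J"
  shows "real m \<le> Re (of_nat m + 1/2 + of_real \<epsilon> * (z - 1/2))"
    and "cmod (of_nat m + 1/2 + of_real \<epsilon> * (z - 1/2)) \<le> real m + 1"
proof -
  have z: "cmod (z - 1/2) \<le> 1/2" using assms(3) by (simp add: J_def)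
  have le: "cmod (of_real \<epsilon> * (z - 1/2)) \<le> 1/2"
  proof -
    have "cmod (of_real \<epsilon> * (z - 1/2)) = \<epsilon> * cmod (z - 1/2)"
      using assms(1) by (simp add: norm_mult)
    also have "\<dots> \<le> 1 * (1/2)" using assms z by (intro mult_mono) auto
    finally show ?thesis by simp
  qed
  have "- (1/2) \<le> Re (of_real \<epsilon> * (z - 1/2))"
    using le abs_Re_le_cmod[of "of_real \<epsilon> * (z - 1/2)"] by linarith
  then show "real m \<le> Re (of_nat m + 1/2 + of_real \<epsilon> * (z - 1/2))" by simp
  have "cmod (of_nat m + 1/2 + of_real \<epsilon> * (z - 1/2)) \<le> cmod (of_nat m + 1/2) + 1/2"
    using norm_triangle_ineq[of "of_nat m + 1/2" "of_real \<epsilon> * (z - 1/2)"] le by linarith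
  also have "cmod (of_nat m + 1/2) = real m + 1/2"
  proof -
    have "(of_nat m + 1/2 :: complex) = of_real (real m + 1/2)" by simp
    then show ?thesis by (simp only: norm_of_real)
  qed
  finally show "cmod (of_nat m + 1/2 + of_real \<epsilon> * (z - 1/2)) \<le> real m + 1" by simp
qed

lemma dist_div_bounds:
  fixes v w :: complex
  assumes "0 < a" "a \<le> cmod v" "a \<le> cmod w" "cmod v \<le> b" "cmod w \<le> b"
  shows "dist v w / b\<^sup>2 \<le> dist (1 / v) (1 / w)" and "dist (1 / v) (1 / w) \<le> dist v w / a\<^sup>2"
proof -
  have vw: "v \<noteq> 0" "w \<noteq> 0" using assms by auto
  have pos: "0 < cmod v * cmod w" using vw by simp
  have "a\<^sup>2 \<le> cmod v * cmod w" "cmod v * cmod w \<le> b\<^sup>2"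
    using assms unfolding power2_eq_square by (auto intro!: mult_mono)
  then show "dist v w / b\<^sup>2 \<le> dist (1 / v) (1 / w)" "dist (1 / v) (1 / w) \<le> dist v w / a\<^sup>2"
    unfolding dist_inverse_complex[OF vw] using pos assms(1)
    by (auto intro!: divide_left_mono mult_pos_pos)
qed

lemma cf_map_dist_bounds:
  assumes \<epsilon>: "0 < \<epsilon>" "\<epsilon> \<le> 1" and z: "z \<in> J" "z' \<in> J" and a: "1 \<le> a"
    and m: "a \<le> m" "m \<le> b" "a \<le> m'" "m' \<le> b"
  defines "w \<equiv> of_nat m + 1/2 + of_real \<epsilon> * (z - 1/2)"
    and "w' \<equiv> of_nat m' + 1/2 + of_real \<epsilon> * (z' - 1/2)"
  shows "dist w w' / (real b + 1)\<^sup>2 \<le> dist (cf_map \<epsilon> (of_nat m) z) (cf_map \<epsilon> (of_nat m') z')"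
    and "dist (cf_map \<epsilon> (of_nat m) z) (cf_map \<epsilon> (of_nat m') z') \<le> dist w w' / (real a)\<^sup>2"
proof -
  have "real a \<le> cmod w" "cmod w \<le> real b + 1"
    using cf_denominator_bounds[OF \<epsilon> z(1), of m] complex_Re_le_cmod[of w] m
    unfolding w_def by linarith+
  moreover have "real a \<le> cmod w'" "cmod w' \<le> real b + 1"
    using cf_denominator_bounds[OF \<epsilon> z(2), of m'] complex_Re_le_cmod[of w'] m
    unfolding w'_def by linarith+
  ultimately show "dist w w' / (real b + 1)\<^sup>2 \<le> dist (cf_map \<epsilon> (of_nat m) z) (cf_map \<epsilon> (of_nat m') z')"
    and "dist (cf_map \<epsilon> (of_nat m) z) (cf_map \<epsilon> (of_nat m') z') \<le> dist w w' / (real a)\<^sup>2"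
    using dist_div_bounds[of "real a" w w' "real b + 1"] a
    unfolding cf_map_def w_def[symmetric] w'_def[symmetric] by auto
qed

lemma cf_map_same_dist_bounds:
  assumes \<epsilon>: "0 < \<epsilon>" "\<epsilon> \<le> 1" and z: "z \<in> J" "z' \<in> J" and a: "1 \<le> a" and m: "a \<le> m" "m \<le> b"
  shows "\<epsilon> / (real b + 1)\<^sup>2 * dist z z' \<le> dist (cf_map \<epsilon> (of_nat m) z) (cf_map \<epsilon> (of_nat m) z')"
    and "dist (cf_map \<epsilon> (of_nat m) z) (cf_map \<epsilon> (of_nat m) z') \<le> 1 / (real a)\<^sup>2 * dist z z'"
proof -
  have "of_real \<epsilon> * (z - 1/2) - of_real \<epsilon> * (z' - 1/2) = of_real \<epsilon> * (z - z')"
    by (simp add: algebra_simps)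
  then have eq: "dist (of_nat m + 1/2 + of_real \<epsilon> * (z - 1/2)) (of_nat m + 1/2 + of_real \<epsilon> * (z' - 1/2))
      = \<epsilon> * dist z z'"
    using \<epsilon> by (simp add: dist_norm norm_mult)
  note b = cf_map_dist_bounds[OF \<epsilon> z a m m, unfolded eq]
  show "\<epsilon> / (real b + 1)\<^sup>2 * dist z z' \<le> dist (cf_map \<epsilon> (of_nat m) z) (cf_map \<epsilon> (of_nat m) z')"
    using b(1) by simp
  have "\<epsilon> * dist z z' / (real a)\<^sup>2 \<le> 1 * dist z z' / (real a)\<^sup>2"
    using \<epsilon> by (intro divide_right_mono mult_right_mono) auto
  then show "dist (cf_map \<epsilon> (of_nat m) z) (cf_map \<epsilon> (of_nat m) z') \<le> 1 / (real a)\<^sup>2 * dist z z'"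
    using b(2) by simp
qed

text \<open>
  The denominators of two different digits range over discs of radius \<open>\<epsilon>/2\<close> whose centres are at least \<open>g\<close>
  apart, hence are at distance at least \<open>g - \<epsilon>\<close> from each other.
\<close>

lemma cf_map_separated:
  assumes \<epsilon>: "0 < \<epsilon>" "\<epsilon> \<le> 1" and z: "z \<in> J" "z' \<in> J" and a: "1 \<le> a"
    and m: "a \<le> m" "m \<le> b" "a \<le> m'" "m' \<le> b" and g: "g \<le> \<bar>real m - real m'\<bar>"
  shows "(g - \<epsilon>) / (real b + 1)\<^sup>2 \<le> dist (cf_map \<epsilon> (of_nat m) z) (cf_map \<epsilon> (of_nat m') z')"
proof -
  let ?w = "of_nat m + 1/2 + of_real \<epsilon> * (z - 1/2)"
  let ?w' = "of_nat m' + 1/2 + of_real \<epsilon> * (z' - 1/2)"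
  have "dist z z' \<le> 1"
    using z norm_triangle_ineq4[of "z - 1/2" "z' - 1/2"]
    by (simp add: J_def dist_norm)
  then have "cmod (of_real \<epsilon> * (z' - z)) \<le> \<epsilon>"
    using \<epsilon> mult_left_mono[of "dist z z'" 1 \<epsilon>] by (simp add: norm_mult dist_norm norm_minus_commute)
  moreover have "(of_nat m - of_nat m' :: complex) = (?w - ?w') + of_real \<epsilon> * (z' - z)"
    by (simp add: algebra_simps)
  then have "cmod (of_nat m - of_nat m') \<le> dist ?w ?w' + cmod (of_real \<epsilon> * (z' - z))"
    unfolding dist_norm by (metis norm_triangle_ineq)
  moreover have "cmod (of_nat m - of_nat m') = \<bar>real m - real m'\<bar>"
    by (metis norm_of_real of_real_diff of_real_of_nat_eq)
  ultimately have "g - \<epsilon> \<le> dist ?w ?w'" using g by linarith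
  then have "(g - \<epsilon>) / (real b + 1)\<^sup>2 \<le> dist ?w ?w' / (real b + 1)\<^sup>2"
    by (rule divide_right_mono) simp
  then show ?thesis using cf_map_dist_bounds(1)[OF \<epsilon> z a m] by linarith
qed

lemma contracting_system_cf_map:
  assumes \<epsilon>: "0 < \<epsilon>" "\<epsilon> \<le> 1" and a: "2 \<le> a" and M: "\<And>m. m \<in> M \<Longrightarrow> a \<le> m"
    and S: "\<And>e z. e \<in> of_nat ` M \<Longrightarrow> S e z = cf_map \<epsilon> e z"
  shows "contracting_system J (of_nat ` M) S (1 / (real a)\<^sup>2)"
proof
  show "compact J" "J \<noteq> {}" unfolding J_eq_cball by auto
  show "S e z \<in> J" if e: "e \<in> of_nat ` M" and z: "z \<in> J" for e z
  proof -
    obtain m where m: "e = of_nat m" "m \<in> M" using e by blast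
    show ?thesis unfolding S[OF e] unfolding cf_map_def m(1)
      using cf_denominator_bounds(1)[OF \<epsilon> z, of m] M[OF m(2)] a by (intro inverse_in_J) linarith
  qed
  show "dist (S e z) (S e z') \<le> 1 / (real a)\<^sup>2 * dist z z'"
    if e: "e \<in> of_nat ` M" and z: "z \<in> J" "z' \<in> J" for e z z'
  proof -
    obtain m where m: "e = of_nat m" "m \<in> M" using e by blast
    show ?thesis unfolding S[OF e] unfolding m(1)
      using a M[OF m(2)] by (intro cf_map_same_dist_bounds(2)[OF \<epsilon> z]) auto
  qed
  show "0 < 1 / (real a)\<^sup>2" using a by simp
  have "1\<^sup>2 < (real a)\<^sup>2" using a by (intro power_strict_mono) auto
  then show "1 / (real a)\<^sup>2 < 1" using a by (simp add: field_simps)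
qed

lemma hausdorff_dim_cf_limit_set_ge:
  assumes \<epsilon>: "0 < \<epsilon>" "\<epsilon> \<le> 1" and M: "M \<subseteq> {a..b}" and a: "2 \<le> a"
    and S: "\<And>e z. e \<in> of_nat ` M \<Longrightarrow> S e z = cf_map \<epsilon> e z"
    and card: "2 \<le> card M" and s: "0 < s"
    and gap: "\<epsilon> < g" "\<And>m m'. m \<in> M \<Longrightarrow> m' \<in> M \<Longrightarrow> m \<noteq> m' \<Longrightarrow> g \<le> \<bar>real m - real m'\<bar>"
    and large: "1 \<le> real (card M) * (\<epsilon> / (real b + 1)\<^sup>2) powr s"
  shows "ennreal s \<le> hausdorff_dim (limit_set J (of_nat ` M) S)"
proof -
  interpret contracting_system J "of_nat ` M" S "1 / (real a)\<^sup>2"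
    using M by (intro contracting_system_cf_map[OF \<epsilon> a] S) auto
  have cardM: "card (of_nat ` M :: complex set) = card M" by (intro card_image) simp
  show ?thesis
  proof (rule hausdorff_dim_limit_set_ge[where r = "\<epsilon> / (real b + 1)\<^sup>2" and d = "(g - \<epsilon>) / (real b + 1)\<^sup>2"])
    show "2 \<le> card (of_nat ` M :: complex set)" using card cardM by simp
    show "0 < s" by fact
    show "0 < \<epsilon> / (real b + 1)\<^sup>2" "0 < (g - \<epsilon>) / (real b + 1)\<^sup>2" using \<epsilon> gap(1) by auto
    show "1 \<le> real (card (of_nat ` M :: complex set)) * (\<epsilon> / (real b + 1)\<^sup>2) powr s"
      using large cardM by simp
    show "\<epsilon> / (real b + 1)\<^sup>2 * dist z z' \<le> dist (S e z) (S e z')"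
      if e: "e \<in> of_nat ` M" and z: "z \<in> J" "z' \<in> J" for e z z'
    proof -
      obtain m where m: "e = of_nat m" "m \<in> M" using e by blast
      show ?thesis unfolding S[OF e] unfolding m(1)
        using a M m(2) by (intro cf_map_same_dist_bounds(1)[OF \<epsilon> z, of a]) auto
    qed
    show "(g - \<epsilon>) / (real b + 1)\<^sup>2 \<le> dist (S e z) (S e' z')"
      if e: "e \<in> of_nat ` M" "e' \<in> of_nat ` M" and ne: "e \<noteq> e'" and z: "z \<in> J" "z' \<in> J" for e e' z z'
    proof -
      obtain m m' where m: "e = of_nat m" "m \<in> M" "e' = of_nat m'" "m' \<in> M" using e by blast
      show ?thesis unfolding S[OF e(1)] S[OF e(2)] unfolding m(1,3)
        using a M m ne gap(2)[of m m'] by (intro cf_map_separated[OF \<epsilon> z, of a]) auto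
    qed
  qed
qed

section \<open>A discontinuity of the dimension\<close>

text \<open>
  The digits are not consecutive because the images of \<open>J\<close> under \<open>T\<close> for two consecutive integers touch.
  They are large enough for the limit set to have small dimension.
\<close>

definition fixed_digits :: "complex set" where "fixed_digits = of_nat ` {16, 18}"

lemma hausdorff_dim_fixed_ge: "ennreal (1/9) \<le> hausdorff_dim (limit_set J fixed_digits T)"
  unfolding fixed_digits_def
proof (rule hausdorff_dim_cf_limit_set_ge[where a = 16 and b = 18 and \<epsilon> = 1 and g = 2])
  have "(1/512::real) powr (1/9) = ((1/2) powr 9) powr (1/9)" by (simp add: power_divide)
  also have "\<dots> = 1/2" unfolding powr_powr by simp
  finally have "1/2 \<le> (1 / 361) powr (1/9::real)"
    using powr_mono2[of "1/9" "1/512" "1/361::real"] by simp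
  then show "1 \<le> real (card {16, 18::nat}) * (1 / (real 18 + 1)\<^sup>2) powr (1/9)" by simp
qed (auto simp: T_eq_cf_map)

lemma hausdorff_dim_fixed_le: "hausdorff_dim (limit_set J fixed_digits T) \<le> ennreal (1/4)"
proof -
  interpret contracting_system J fixed_digits T "1 / (real 16)\<^sup>2"
    unfolding fixed_digits_def
    by (rule contracting_system_cf_map[of 1]) (auto simp: T_eq_cf_map)
  have "(1/256::real) powr (1/4) = ((1/4) powr 4) powr (1/4)" by (simp add: power_divide)
  also have "\<dots> = 1/4" unfolding powr_powr by simp
  finally have "(1/256::real) powr (1/4) = 1/4" .
  moreover have "card fixed_digits = 2" by (simp add: fixed_digits_def)
  ultimately show ?thesis
    by (intro hausdorff_dim_limit_set_le) (auto simp: fixed_digits_def)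
qed

lemma limit_set_mono: "F \<subseteq> G \<Longrightarrow> limit_set X F S \<subseteq> limit_set X G S"
  unfolding limit_set_def by auto

lemma hausdorff_dim_mono:
  assumes "A \<subseteq> B"
  shows "hausdorff_dim A \<le> hausdorff_dim B"
proof -
  have "hausdorff_premeasure s \<delta> A \<le> hausdorff_premeasure s \<delta> B" for s \<delta>
    unfolding hausdorff_premeasure_def
    by (rule INF_superset_mono) (use assms in \<open>auto simp: countable_covers_def\<close>)
  then have "hausdorff_measure s A \<le> hausdorff_measure s B" for s
    unfolding hausdorff_measure_def by (intro SUP_mono) auto
  then show ?thesis unfolding hausdorff_dim_def
    by (intro INF_superset_mono) (auto simp: le_zero_eq[symmetric] simp del: le_zero_eq intro: order_trans)
qed

text \<open>
  For a single \<open>\<epsilon>\<close> finitely many perturbed digits are enough, but how many are needed grows with \<open>1/\<epsilon>\<close>;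
  only an infinite alphabet gives the bound for all \<open>\<epsilon>\<close> at once.
\<close>

lemma hausdorff_dim_perturbed_ge:
  assumes \<epsilon>: "0 < \<epsilon>" "\<epsilon> < 1"
  shows "ennreal (1/3) \<le> hausdorff_dim (limit_set J (of_nat ` {16..}) (T_pert fixed_digits \<epsilon>))"
proof -
  obtain N0 :: nat where N0: "4 / \<epsilon> \<le> real N0" using real_arch_simple by blast
  \<comment> \<open>All digits from 19 on are perturbed, and \<open>4/\<epsilon> \<le> N\<close> means \<open>N\<^sup>-\<^sup>3 \<le> \<epsilon> / (2N)\<^sup>2\<close>.\<close>
  define N where "N = max 19 N0"
  have N: "19 \<le> N" "4 / \<epsilon> \<le> real N" using N0 by (auto simp: N_def)
  have "ennreal (1/3) \<le> hausdorff_dim (limit_set J (of_nat ` {N..2 * N - 1}) (T_pert fixed_digits \<epsilon>))"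
  proof (rule hausdorff_dim_cf_limit_set_ge[where a = N and b = "2 * N - 1" and g = 1])
    show "T_pert fixed_digits \<epsilon> e z = cf_map \<epsilon> e z" if "e \<in> of_nat ` {N..2 * N - 1}" for e z
      using that N by (intro T_pert_eq_cf_map) (auto simp: fixed_digits_def simp del: image_insert of_nat_numeral)
    have "real (2 * N - 1) + 1 = 2 * real N" using N by (simp add: of_nat_diff)
    moreover have "1 / real N ^ 3 \<le> \<epsilon> / (2 * real N)\<^sup>2"
      using N \<epsilon> by (simp add: field_simps power2_eq_square power3_eq_cube)
    then have "(1 / real N ^ 3) powr (1/3) \<le> (\<epsilon> / (2 * real N)\<^sup>2) powr (1/3)"
      by (intro powr_mono2) auto
    moreover have "(1 / real N ^ 3) powr (1/3) = 1 / real N"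
    proof -
      have "(1 / real N ^ 3) = (1 / real N) powr 3" using N by (simp add: power_one_over)
      then show ?thesis by (simp only: powr_powr) (use N in simp)
    qed
    ultimately have "1 / real N \<le> (\<epsilon> / (real (2 * N - 1) + 1)\<^sup>2) powr (1/3)" by simp
    then show "1 \<le> real (card {N..2 * N - 1}) * (\<epsilon> / (real (2 * N - 1) + 1)\<^sup>2) powr (1/3)"
      using N by (simp add: field_simps)
  qed (use N \<epsilon> in auto)
  also have "\<dots> \<le> hausdorff_dim (limit_set J (of_nat ` {16..}) (T_pert fixed_digits \<epsilon>))"
    using N by (intro hausdorff_dim_mono limit_set_mono) auto
  finally show ?thesis .
qed

theorem proposition4p4:
  shows "\<exists>Ehat E :: complex set.
    Ehat \<noteq> {} \<and> Ehat \<subseteq> E_star \<and> E \<subseteq> Ehat \<and>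
    hausdorff_dim (limit_set J E T) > 0 \<and>
    \<not> ((\<lambda>\<epsilon>. hausdorff_dim (limit_set J Ehat (T_pert E \<epsilon>)))
         \<longlongrightarrow> hausdorff_dim (limit_set J E T)) (at_right (0::real))"
proof -
  let ?Ehat = "of_nat ` {16..} :: complex set"
  let ?dim = "\<lambda>\<epsilon>. hausdorff_dim (limit_set J ?Ehat (T_pert fixed_digits \<epsilon>))"
  have "?Ehat \<subseteq> E_star"
  proof
    fix e :: complex assume "e \<in> ?Ehat"
    then obtain m :: nat where "e = of_nat m" "16 \<le> m" by auto
    then have "e = of_int (int m) + of_int 0 * \<i> \<and> 1 \<le> int m" by simp
    then show "e \<in> E_star" unfolding E_star_def by blast
  qed
  moreover have "fixed_digits \<subseteq> ?Ehat"
    unfolding fixed_digits_def by (rule image_mono) auto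
  moreover have "?Ehat \<noteq> {}" by simp
  moreover have "0 < hausdorff_dim (limit_set J fixed_digits T)"
  proof -
    have "0 < ennreal (1/9)" by simp
    then show ?thesis using hausdorff_dim_fixed_ge by (rule less_le_trans)
  qed
  moreover have "\<not> (?dim \<longlongrightarrow> hausdorff_dim (limit_set J fixed_digits T)) (at_right 0)"
  proof
    assume "(?dim \<longlongrightarrow> hausdorff_dim (limit_set J fixed_digits T)) (at_right 0)"
    then have "ennreal (1/3) \<le> hausdorff_dim (limit_set J fixed_digits T)"
    proof (rule tendsto_lowerbound)
      show "\<forall>\<^sub>F \<epsilon> in at_right 0. ennreal (1/3) \<le> ?dim \<epsilon>"
        unfolding eventually_at_right_field
        by (intro exI[of _ 1]) (auto intro: hausdorff_dim_perturbed_ge)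
    qed simp
    then have "ennreal (1/3) \<le> ennreal (1/4)" using hausdorff_dim_fixed_le by (rule order_trans)
    then show False by simp
  qed
  ultimately show ?thesis
    by (intro exI[of _ ?Ehat] exI[of _ fixed_digits] conjI)
qed

end
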